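(* Let $\mathbf{k}$ be a field of characteristic zero. For integers $m\ge 2$, $n\ge 1$ and $k\ge 0$, with $\mathbf{m}=(m,\dots,m)$ of length $2n$, the coefficient $C^{(m-1)}_{n,k}$ of the $(m-1)$-Catalan triangle counts the $\mathbf{m}$-admissible lattice paths of degree $n(m-1)-k$ whose corresponding $\mathbf{m}$-free monomials in $\mathbf{k}[x_1,\dots,x_{2n}]$ are not in the initial ideal $\mathrm{in}(I_{2n,\mathbf{m},1})$.
   Context: For $s\ge1$ and $n\geq 0$ the $s$-binomial coefficients $\binom{n}{d}_s$ are defined by $(1+x+\cdots+x^s)^n=\sum_{d\in\mathbb{Z}}\binom{n}{d}_s x^d$. The $s$-Catalan triangle has entries, for $n>0$ and $k\ge 0$, $$C^{(s)}_{n,k}=\binom{2n}{sn+k}_s-\binom{2n}{sn+k+1}_s ,$$ and $C^{(s)}_{0,0}=1$. For $N\ge1$ and $\mathbf{m}=(m_1,\dots,m_N)$ with $m_i\geq 2$, a monomial $x_1^{\alpha_1}\cdots x_N^{\alpha_N}$ is $\mathbf{m}$-free if $\alpha_i<m_i$ for all $i$. Its lattice path starts at $(0,0)$ and has $N$ steps, the $i$-th being $(1,1-\alpha_i)$; the paths so obtained are the $\mathbf{m}$-admissible lattice paths, and this is a bijection between $\mathbf{m}$-free monomials and $\mathbf{m}$-admissible paths. The degree of a path is the degree of its monomial. $I_{2n,\mathbf{m},1}=(x_1^m,\dots,x_{2n}^m,\,x_1+\cdots+x_{2n})\subseteq\mathbf{k}[x_1,\dots,x_{2n}]$, and the initial ideal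 is taken with respect to a monomial ordering with $x_1\succ\cdots\succ x_{2n}$ (it does not depend on which such ordering is chosen). *)

theory Defs
  imports
    Complex_Main
    "HOL-Library.Poly_Mapping"
    "HOL-Library.Product_Plus"
    "HOL-Computational_Algebra.Polynomial"
begin

definition s_binomial :: "nat \<Rightarrow> nat \<Rightarrow> int \<Rightarrow> int" where
  "s_binomial s n d =
     (if d < 0 then 0 else coeff ((\<Sum>i\<le>s. monom 1 i) ^ n) (nat d))"

definition s_catalan :: "nat \<Rightarrow> nat \<Rightarrow> nat \<Rightarrow> int" where
  "s_catalan s n k =
     (if n = 0 then (if k = 0 then 1 else 0)
      else s_binomial s (2 * n) (int s * int n + int k)
         - s_binomial s (2 * n) (int s * int n + int k + 1))"

text \<open>
  A monomial is its exponent vector, and a polynomial is a finitely supported map from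
  monomials to coefficients. The variables are indexed by all of \<^typ>\<open>nat\<close>; the ring
  \<open>k[x\<^sub>1, \<dots>, x\<^sub>N]\<close> is the subset \<open>polys N\<close>, and ideals are generated inside it.
\<close>

type_synonym monomial = "nat \<Rightarrow>\<^sub>0 nat"
type_synonym 'k mpoly = "monomial \<Rightarrow>\<^sub>0 'k"

definition monomials :: "nat \<Rightarrow> monomial set" where
  "monomials N = {\<alpha>. Poly_Mapping.keys \<alpha> \<subseteq> {1..N}}"

definition polys :: "nat \<Rightarrow> 'k::field mpoly set" where
  "polys N = {p. Poly_Mapping.keys p \<subseteq> monomials N}"

definition mdegree :: "monomial \<Rightarrow> nat" where
  "mdegree \<alpha> = (\<Sum>i\<in>Poly_Mapping.keys \<alpha>. Poly_Mapping.lookup \<alpha> i)"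

definition var_mon :: "nat \<Rightarrow> monomial" where
  "var_mon i = Poly_Mapping.single i 1"

definition mon_poly :: "monomial \<Rightarrow> 'k::field mpoly" where
  "mon_poly \<alpha> = Poly_Mapping.single \<alpha> 1"

definition var :: "nat \<Rightarrow> 'k::field mpoly" where
  "var i = mon_poly (var_mon i)"

definition ideal_gen :: "nat \<Rightarrow> 'k::field mpoly set \<Rightarrow> 'k mpoly set" where
  "ideal_gen N G =
     {(\<Sum>g\<in>F. c g * g) | F c. finite F \<and> F \<subseteq> G \<and> (\<forall>g\<in>F. c g \<in> polys N)}"

definition I1 :: "nat \<Rightarrow> (nat \<Rightarrow> nat) \<Rightarrow> 'k::field mpoly set" where
  "I1 N m = ideal_gen N (insert (\<Sum>i=1..N. var i) {var i ^ m i | i. i \<in> {1..N}})"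

text \<open>
  A relation \<open>r\<close> encodes an ordering by \<open>(\<alpha>, \<beta>) \<in> r\<close> iff \<open>\<alpha> \<preceq> \<beta>\<close>.
\<close>

definition monomial_order :: "nat \<Rightarrow> monomial rel \<Rightarrow> bool" where
  "monomial_order N r \<longleftrightarrow>
     well_order_on (monomials N) r \<and>
     (\<forall>(\<alpha>, \<beta>)\<in>r. \<forall>\<gamma>\<in>monomials N. (\<alpha> + \<gamma>, \<beta> + \<gamma>) \<in> r)"

definition vars_decreasing :: "nat \<Rightarrow> monomial rel \<Rightarrow> bool" where
  "vars_decreasing N r \<longleftrightarrow>
     (\<forall>i\<in>{1..N}. \<forall>j\<in>{1..N}. i < j \<longrightarrow> (var_mon j, var_mon i) \<in> r)"

definition initial_monomial :: "monomial rel \<Rightarrow> 'k::field mpoly \<Rightarrow> monomial" where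
  "initial_monomial r p =
     (THE \<alpha>. \<alpha> \<in> Poly_Mapping.keys p \<and> (\<forall>\<beta>\<in>Poly_Mapping.keys p. (\<beta>, \<alpha>) \<in> r))"

definition initial_ideal :: "nat \<Rightarrow> monomial rel \<Rightarrow> 'k::field mpoly set \<Rightarrow> 'k mpoly set" where
  "initial_ideal N r I = ideal_gen N {mon_poly (initial_monomial r p) | p. p \<in> I \<and> p \<noteq> 0}"

definition m_free :: "nat \<Rightarrow> (nat \<Rightarrow> nat) \<Rightarrow> monomial set" where
  "m_free N m = {\<alpha> \<in> monomials N. \<forall>i\<in>{1..N}. Poly_Mapping.lookup \<alpha> i < m i}"

text \<open>
  A path is the list of its \<open>N + 1\<close> lattice points. The sum is one of pairs, so the list starts
  at the origin and each point is the previous one plus the step \<open>(1, 1 - \<alpha>\<^sub>i)\<close>.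
\<close>

type_synonym path = "(int \<times> int) list"

definition path_of :: "nat \<Rightarrow> monomial \<Rightarrow> path" where
  "path_of N \<alpha> = map (\<lambda>j. \<Sum>i=1..j. (1, 1 - int (Poly_Mapping.lookup \<alpha> i))) [0..<Suc N]"

definition admissible_paths :: "nat \<Rightarrow> (nat \<Rightarrow> nat) \<Rightarrow> path set" where
  "admissible_paths N m = path_of N ` m_free N m"

definition monomial_of :: "nat \<Rightarrow> (nat \<Rightarrow> nat) \<Rightarrow> path \<Rightarrow> monomial" where
  "monomial_of N m = inv_into (m_free N m) (path_of N)"

definition path_degree :: "nat \<Rightarrow> (nat \<Rightarrow> nat) \<Rightarrow> path \<Rightarrow> nat" where
  "path_degree N m P = mdegree (monomial_of N m P)"

lemma path_of_bij: "bij_betw (path_of N) (m_free N m) (admissible_paths N m)"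
proof -
  have "inj_on (path_of N) (m_free N m)"
  proof (rule inj_onI)
    fix \<alpha> \<beta> assume a: "\<alpha> \<in> m_free N m" and b: "\<beta> \<in> m_free N m"
      and eq: "path_of N \<alpha> = path_of N \<beta>"
    let ?S = "\<lambda>\<alpha> j. \<Sum>i=1..j. (1::int, 1 - int (Poly_Mapping.lookup \<alpha> i))"
    have S: "?S \<alpha> j = ?S \<beta> j" if "j \<le> N" for j
      using eq that unfolding path_of_def by (auto simp del: upt_Suc)
    show "\<alpha> = \<beta>"
    proof (rule poly_mapping_eqI)
      fix i
      show "Poly_Mapping.lookup \<alpha> i = Poly_Mapping.lookup \<beta> i"
      proof (cases "i \<in> {1..N}")
        case True
        then obtain j where j: "i = Suc j" "Suc j \<le> N" by (cases i) auto
        then show ?thesis using S[of j] S[of "Suc j"] by simp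
      next
        case False
        then have "i \<notin> Poly_Mapping.keys \<alpha>" "i \<notin> Poly_Mapping.keys \<beta>"
          using a b unfolding m_free_def monomials_def by blast+
        then show ?thesis by (simp add: in_keys_iff)
      qed
    qed
  qed
  then show ?thesis by (simp add: bij_betw_def admissible_paths_def)
qed

end

theory Submission
  imports Defs "HOL-Library.FuncSet"
begin

text \<open>
  Let \<open>A = k[x\<^sub>1, \<dots>, x\<^sub>N] / (x\<^sub>i\<^bsup>m i\<^esup>)\<close> and let \<open>\<ell>\<close> be the sum of the variables. Multiplication by \<open>\<ell>\<close> is
  the raising operator of an \<open>sl\<^sub>2\<close>-action on \<open>A\<close>, with lowering operator
  \<open>x\<^sub>i\<^bsup>a\<^esup> \<mapsto> a (m i - a) x\<^sub>i\<^bsup>a - 1\<^esup>\<close> summed over the variables. If \<open>\<ell> f = 0\<close> with \<open>f\<close> of degree \<open>e\<close> and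
  \<open>2 e < \<Sum>\<^sub>i (m i - 1)\<close>, the commutator relation shows that raising takes the \<open>(j + 1)\<close>-st lowering of
  \<open>f\<close> to a nonzero (negative) multiple of the \<open>j\<close>-th one; the \<open>(e + 1)\<close>-st lowering is zero for degree
  reasons, hence \<open>f = 0\<close>. So \<open>\<ell>\<close> is injective from degree \<open>d - 1\<close> to degree \<open>d\<close> up to the middle degree.
  Since the standard monomials of degree \<open>d\<close> form a basis of a complement of \<open>\<ell> A\<^bsub>d - 1\<^esub>\<close> in \<open>A\<^bsub>d\<^esub>\<close>, their
  number is \<open>dim A\<^bsub>d\<^esub> - dim A\<^bsub>d - 1\<^esub>\<close>, a difference of \<open>s\<close>-binomial coefficients, which the symmetry of
  these coefficients turns into the entry of the \<open>s\<close>-Catalan triangle.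
\<close>

section \<open>Exponent vectors, degrees and m-free monomials\<close>

lemma mdegree_eq_sum:
  "\<alpha> \<in> monomials N \<Longrightarrow> mdegree \<alpha> = (\<Sum>i=1..N. Poly_Mapping.lookup \<alpha> i)"
  unfolding mdegree_def monomials_def
  by (rule sum.mono_neutral_left) (auto simp: in_keys_iff)

lemma lookup_var_mon: "Poly_Mapping.lookup (var_mon i) j = (if i = j then 1 else 0)"
  by (simp add: var_mon_def lookup_single when_def)

lemma var_mon_in_monomials: "i \<in> {1..N} \<Longrightarrow> var_mon i \<in> monomials N"
  by (auto simp: monomials_def var_mon_def)

lemma add_in_monomials_iff:
  "\<alpha> + \<beta> \<in> monomials N \<longleftrightarrow> \<alpha> \<in> monomials N \<and> \<beta> \<in> monomials N"
  by (auto simp: monomials_def subset_iff in_keys_iff lookup_add)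

lemma mdegree_add: "mdegree (\<alpha> + \<beta>) = mdegree \<alpha> + mdegree \<beta>"
proof -
  let ?K = "Poly_Mapping.keys \<alpha> \<union> Poly_Mapping.keys \<beta>"
  have "mdegree \<gamma> = (\<Sum>i\<in>?K. Poly_Mapping.lookup \<gamma> i)" if "Poly_Mapping.keys \<gamma> \<subseteq> ?K" for \<gamma>
    unfolding mdegree_def using that
    by (intro sum.mono_neutral_left) (auto simp: in_keys_iff)
  moreover have "Poly_Mapping.keys (\<alpha> + \<beta>) \<subseteq> ?K"
    by (auto simp: in_keys_iff lookup_add)
  ultimately show ?thesis
    by (simp add: lookup_add sum.distrib)
qed

lemma mdegree_var_mon [simp]: "mdegree (var_mon i) = 1"
  by (simp add: mdegree_def var_mon_def)

lemma var_mon_add_minus: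
  "Poly_Mapping.lookup \<alpha> i > 0 \<Longrightarrow> var_mon i + (\<alpha> - var_mon i) = \<alpha>"
  by (rule poly_mapping_eqI) (auto simp: lookup_add lookup_minus lookup_var_mon)

lemma m_free_add_var_mon:
  assumes "\<alpha> \<in> m_free N m" "i \<in> {1..N}" "Suc (Poly_Mapping.lookup \<alpha> i) < m i"
  shows "\<alpha> + var_mon i \<in> m_free N m"
  using assms var_mon_in_monomials[of i N]
  by (auto simp: m_free_def add_in_monomials_iff lookup_add lookup_var_mon)

lemma m_free_leD:
  assumes "\<alpha> + \<beta> \<in> m_free N m"
  shows "\<alpha> \<in> m_free N m"
  using assms by (fastforce simp: m_free_def add_in_monomials_iff lookup_add)

section \<open>The operators of the \<open>sl\<^sub>2\<close>-action\<close>

text \<open>This is multiplication by the sum of the variables, written on coefficient functions.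
  The functions live on all monomials; the quotient A is modelled by looking at values on m-free
  monomials only. The test for exponent 0 is needed because subtraction of exponents is
  truncated.\<close>

definition raising :: "nat \<Rightarrow> (monomial \<Rightarrow> 'a::comm_ring_1) \<Rightarrow> monomial \<Rightarrow> 'a" where
  "raising N f \<alpha> =
     (\<Sum>i=1..N. if Poly_Mapping.lookup \<alpha> i = 0 then 0 else f (\<alpha> - var_mon i))"

text \<open>On coefficient functions the value at \<alpha> is collected from the monomials one step
  above it. With a the exponent of \<open>x_i\<close> in \<open>\<alpha> + var_mon i\<close>, the
  factor is the a (m i - a) of the lowering operator.\<close>

definition lowering :: "nat \<Rightarrow> (nat \<Rightarrow> nat) \<Rightarrow> (monomial \<Rightarrow> 'a::comm_ring_1) \<Rightarrow> monomial \<Rightarrow> 'a" where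
  "lowering N m f \<alpha> =
     (\<Sum>i=1..N. of_int ((int (Poly_Mapping.lookup \<alpha> i) + 1) * (int (m i) - 1 - int (Poly_Mapping.lookup \<alpha> i)))
        * f (\<alpha> + var_mon i))"

text \<open>Raising in one variable commutes with lowering in a different one, so only the diagonal
  terms contribute. There, with a the exponent of \<open>x_i\<close> in \<alpha>, the two orders
  differ by a (m i - a) - (a + 1)(m i - 1 - a) = 2 a - m i + 1.\<close>

lemma raising_lowering_commutator:
  "raising N (lowering N m f) \<alpha> = lowering N m (raising N f) \<alpha>
     + of_int (\<Sum>i=1..N. 2 * int (Poly_Mapping.lookup \<alpha> i) - int (m i) + 1) * f \<alpha>"
proof -
  let ?l = "Poly_Mapping.lookup"
  define c where "c j \<beta> = (int (?l \<beta> j) + 1) * (int (m j) - 1 - int (?l \<beta> j))" for j \<beta>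
  define A where "A i j = (if ?l \<alpha> i = 0 then 0
    else of_int (c j (\<alpha> - var_mon i)) * f (\<alpha> - var_mon i + var_mon j))" for i j
  define B where "B i j = of_int (c j \<alpha>) *
    (if ?l (\<alpha> + var_mon j) i = 0 then 0 else f (\<alpha> + var_mon j - var_mon i))" for i j
  define D where "D i j = (if i = j then of_int (2 * int (?l \<alpha> i) - int (m i) + 1) * f \<alpha> else 0)" for i j
  have AB: "A i j = B i j + D i j" for i j
  proof (cases "i = j")
    case True
    have "\<alpha> - var_mon j + var_mon j = \<alpha>" if "?l \<alpha> j \<noteq> 0"
      using var_mon_add_minus[of \<alpha> j] that by (simp add: add.commute)
    moreover have "c j (\<alpha> - var_mon j) = int (?l \<alpha> j) * (int (m j) - int (?l \<alpha> j))" if "?l \<alpha> j \<noteq> 0"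
      using that by (auto simp: c_def lookup_minus lookup_var_mon of_nat_diff)
    ultimately show ?thesis
      using True unfolding A_def B_def D_def
      by (simp add: lookup_add lookup_var_mon c_def flip: distrib_right of_int_add)
        (auto simp: algebra_simps)
  next
    case False
    have "\<alpha> - var_mon i + var_mon j = \<alpha> + var_mon j - var_mon i"
      if "?l \<alpha> i \<noteq> 0"
      using that False
      by (intro poly_mapping_eqI) (auto simp: lookup_add lookup_minus lookup_var_mon)
    then show ?thesis
      using False by (simp add: A_def B_def D_def lookup_add lookup_minus lookup_var_mon c_def)
  qed
  have "raising N (lowering N m f) \<alpha> = (\<Sum>i=1..N. \<Sum>j=1..N. A i j)"
    unfolding raising_def lowering_def A_def c_def by (auto intro!: sum.cong)
  also have "\<dots> = (\<Sum>i=1..N. \<Sum>j=1..N. B i j) + (\<Sum>i=1..N. \<Sum>j=1..N. D i j)"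
    by (simp add: AB sum.distrib)
  also have "(\<Sum>i=1..N. \<Sum>j=1..N. B i j) = lowering N m (raising N f) \<alpha>"
    unfolding raising_def lowering_def B_def c_def
    by (subst sum.swap) (simp add: sum_distrib_left)
  also have "(\<Sum>i=1..N. \<Sum>j=1..N. D i j)
      = of_int (\<Sum>i=1..N. 2 * int (?l \<alpha> i) - int (m i) + 1) * f \<alpha>"
    by (simp add: D_def sum_distrib_right)
  finally show ?thesis .
qed

text \<open>Divisors of m-free monomials are m-free, so raising only consults m-free monomials
  there. This makes the operator well defined on A.\<close>

lemma raising_cong:
  assumes "\<And>\<beta>. \<beta> \<in> m_free N m \<Longrightarrow> f \<beta> = g \<beta>" "\<alpha> \<in> m_free N m"
  shows "raising N f \<alpha> = raising N g \<alpha>"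
  unfolding raising_def
proof (rule sum.cong[OF refl])
  fix i
  have "\<alpha> - var_mon i \<in> m_free N m" if "Poly_Mapping.lookup \<alpha> i \<noteq> 0"
    using m_free_leD[of "\<alpha> - var_mon i" "var_mon i" N m] var_mon_add_minus[of \<alpha> i] that assms(2)
    by (simp add: add.commute)
  then show "(if Poly_Mapping.lookup \<alpha> i = 0 then 0 else f (\<alpha> - var_mon i)) =
      (if Poly_Mapping.lookup \<alpha> i = 0 then 0 else g (\<alpha> - var_mon i))"
    using assms(1) by simp
qed

lemma lowering_cong:
  assumes "\<And>\<beta>. \<beta> \<in> m_free N m \<Longrightarrow> f \<beta> = g \<beta>" "\<alpha> \<in> m_free N m"
  shows "lowering N m f \<alpha> = lowering N m g \<alpha>"
  unfolding lowering_def
proof (rule sum.cong[OF refl])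
  fix i assume i: "i \<in> {1..N}"
  let ?c = "(int (Poly_Mapping.lookup \<alpha> i) + 1) * (int (m i) - 1 - int (Poly_Mapping.lookup \<alpha> i))"
  \<comment> \<open>The coefficient vanishes at exponent \<open>m i - 1\<close>, exactly where \<open>\<alpha> + var_mon i\<close> leaves the
    \<open>m\<close>-free monomials.\<close>
  have "Poly_Mapping.lookup \<alpha> i < m i"
    using assms(2) i by (simp add: m_free_def)
  then have "Suc (Poly_Mapping.lookup \<alpha> i) = m i \<or> Suc (Poly_Mapping.lookup \<alpha> i) < m i"
    by linarith
  then have "?c = 0 \<or> \<alpha> + var_mon i \<in> m_free N m"
    using m_free_add_var_mon[OF assms(2) i] by auto
  then show "of_int ?c * f (\<alpha> + var_mon i) = of_int ?c * g (\<alpha> + var_mon i)"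
    using assms(1) by (elim disjE) (simp_all del: of_int_mult)
qed

lemma raising_zero: "raising N (\<lambda>_. 0) \<alpha> = 0"
  by (simp add: raising_def)

lemma lowering_mult: "lowering N m (\<lambda>\<beta>. c * f \<beta>) \<alpha> = c * lowering N m f \<alpha>"
  by (simp add: lowering_def sum_distrib_left ac_simps)

theorem raising_injective:
  fixes f :: "monomial \<Rightarrow> 'a::field_char_0"
  assumes hom: "\<And>\<alpha>. mdegree \<alpha> \<noteq> e \<Longrightarrow> f \<alpha> = 0"
    and less: "2 * int e < (\<Sum>i=1..N. int (m i) - 1)"
    and zero: "\<And>\<alpha>. \<alpha> \<in> m_free N m \<Longrightarrow> raising N f \<alpha> = 0"
    and "\<alpha> \<in> m_free N m"
  shows "f \<alpha> = 0"
proof -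
  define \<mu> where "\<mu> = (\<Sum>i=1..N. int (m i) - 1)"
  define F where "F j = (lowering N m ^^ j) f" for j
  have F_Suc: "F (Suc j) = lowering N m (F j)" for j
    by (simp add: F_def)
  \<comment> \<open>Comparing \<open>mdegree \<alpha> + j\<close> with e avoids truncated
    subtraction; for j = e + 1 it yields vanishing at every monomial.\<close>
  have F_hom: "F j \<alpha> = 0" if "mdegree \<alpha> + j \<noteq> e" for j \<alpha>
    using that
  proof (induction j arbitrary: \<alpha>)
    case 0
    then show ?case by (simp add: F_def hom)
  next
    case (Suc j)
    have "F j (\<alpha> + var_mon i) = 0" for i
      using Suc.prems by (intro Suc.IH) (simp add: mdegree_add)
    then show ?case unfolding F_Suc by (simp add: lowering_def)
  qed
  \<comment> \<open>Moving raising past j lowerings collects one commutator scalar for each of the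
    degrees e, e - 1, ..., e - j + 1.\<close>
  define c where "c j = (\<Sum>i<j. 2 * (int e - int i) - \<mu>)" for j
  \<comment> \<open>Every summand is at most 2 e - \<mu> < 0. In characteristic zero the scalar
    therefore stays nonzero in the field.\<close>
  have c_neg: "c (Suc j) < 0" for j
    using sum_strict_mono[of "{..<Suc j}" "\<lambda>i. 2 * (int e - int i) - \<mu>" "\<lambda>_. 0"] less
    by (auto simp: c_def \<mu>_def)
  \<comment> \<open>The commutator scalar depends on \<alpha> through its degree alone: it is the
    weight of that degree.\<close>
  have weight: "(\<Sum>i=1..N. 2 * int (Poly_Mapping.lookup \<alpha> i) - int (m i) + 1) =
      2 * int (mdegree \<alpha>) - \<mu>" if "\<alpha> \<in> m_free N m" for \<alpha>
    using that by (simp add: m_free_def mdegree_eq_sum[where N = N] \<mu>_def sum_subtractf sum.distrib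
      flip: sum_distrib_left)
  have raising_F: "raising N (F (Suc j)) \<alpha> = of_int (c (Suc j)) * F j \<alpha>" if "\<alpha> \<in> m_free N m" for j \<alpha>
    using that
  proof (induction j arbitrary: \<alpha>)
    case 0
    have "lowering N m (raising N f) \<alpha> = lowering N m (\<lambda>_. 0) \<alpha>"
      using zero 0 by (intro lowering_cong) auto
    also have "\<dots> = 0" by (simp add: lowering_def)
    finally show ?case
      using raising_lowering_commutator[of N m f \<alpha>, unfolded weight[OF 0]] hom[of \<alpha>]
      by (cases "mdegree \<alpha> = e") (auto simp: F_def c_def)
  next
    case (Suc j)
    have "lowering N m (raising N (F (Suc j))) \<alpha> = lowering N m (\<lambda>\<beta>. of_int (c (Suc j)) * F j \<beta>) \<alpha>"
      using Suc by (intro lowering_cong) auto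
    also have "\<dots> = of_int (c (Suc j)) * F (Suc j) \<alpha>"
      by (simp add: lowering_mult F_Suc)
    finally have *: "raising N (F (Suc (Suc j))) \<alpha> =
        of_int (c (Suc j)) * F (Suc j) \<alpha> + of_int (2 * int (mdegree \<alpha>) - \<mu>) * F (Suc j) \<alpha>"
      using raising_lowering_commutator[of N m "F (Suc j)" \<alpha>, unfolded weight[OF Suc.prems]]
      by (simp add: F_Suc)
    show ?case
    proof (cases "mdegree \<alpha> + Suc j = e")
      case True
      then have "c (Suc (Suc j)) = c (Suc j) + (2 * int (mdegree \<alpha>) - \<mu>)"
        by (auto simp: c_def)
      then show ?thesis unfolding * by (simp add: distrib_right)
    next
      \<comment> \<open>In every other degree \<open>F (Suc j)\<close> vanishes at \<alpha>, so the
        value of the scalar is irrelevant.\<close>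
      case False
      then show ?thesis using F_hom[OF False] * by simp
    qed
  qed
  \<comment> \<open>Downward induction from j = e + 1: if \<open>F (Suc j)\<close> vanishes on
    m-free monomials, so does its raising, which is a nonzero multiple of
    \<open>F j\<close>.\<close>
  have "\<forall>\<alpha>\<in>m_free N m. F j \<alpha> = 0" if "j \<le> Suc e" for j
    using that
  proof (induction j rule: inc_induct)
    case base
    then show ?case using F_hom by auto
  next
    case (step j)
    show ?case
    proof
      fix \<alpha> assume \<alpha>: "\<alpha> \<in> m_free N m"
      have "raising N (F (Suc j)) \<alpha> = 0"
        using step.IH \<alpha> raising_cong[of N m "F (Suc j)" "\<lambda>_. 0" \<alpha>] by (simp add: raising_zero)
      then show "F j \<alpha> = 0"
        using raising_F[OF \<alpha>, of j]
          c_neg[of j] by auto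
    qed
  qed
  from this[of 0] show ?thesis
    using assms(4) by (simp add: F_def)
qed

section \<open>Multiplication by monomials and by the linear form\<close>

lemma lookup_mon_poly: "Poly_Mapping.lookup (mon_poly \<alpha>) \<beta> = (if \<alpha> = \<beta> then 1 else 0)"
  by (simp add: mon_poly_def lookup_single when_def)

lemma mon_poly_in_polys: "\<alpha> \<in> monomials N \<Longrightarrow> mon_poly \<alpha> \<in> polys N"
  by (simp add: mon_poly_def polys_def)

lemma poly_mapping_eq_sum_single:
  assumes "finite K" "Poly_Mapping.keys p \<subseteq> K"
  shows "p = (\<Sum>\<alpha>\<in>K. Poly_Mapping.single \<alpha> (Poly_Mapping.lookup p \<alpha>))"
proof (rule poly_mapping_eqI)
  fix \<gamma>
  have "Poly_Mapping.lookup p \<gamma> = 0" if "\<gamma> \<notin> K"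
    using that assms(2) by (auto simp: in_keys_iff)
  then show "Poly_Mapping.lookup p \<gamma> =
      Poly_Mapping.lookup (\<Sum>\<alpha>\<in>K. Poly_Mapping.single \<alpha> (Poly_Mapping.lookup p \<alpha>)) \<gamma>"
    using assms(1) by (auto simp: lookup_sum lookup_single when_def)
qed

text \<open>Divisibility is expressed through a cofactor \<gamma>, since the truncated difference
  \<open>\<alpha> - \<beta>\<close> exists even when \<beta> does not divide \<alpha>.\<close>

lemma lookup_mon_poly_mult:
  "Poly_Mapping.lookup (mon_poly \<beta> * p) \<alpha> =
     (if \<exists>\<gamma>. \<alpha> = \<beta> + \<gamma> then Poly_Mapping.lookup p (\<alpha> - \<beta>) else 0)"
proof -
  have "mon_poly \<beta> * p = (\<Sum>\<gamma>\<in>Poly_Mapping.keys p.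
      Poly_Mapping.single (\<beta> + \<gamma>) (Poly_Mapping.lookup p \<gamma>))"
    by (subst poly_mapping_eq_sum_single[of "Poly_Mapping.keys p" p])
      (simp_all add: sum_distrib_left mon_poly_def mult_single)
  then have *: "Poly_Mapping.lookup (mon_poly \<beta> * p) \<alpha> =
      (\<Sum>\<gamma>\<in>Poly_Mapping.keys p. if \<beta> + \<gamma> = \<alpha> then Poly_Mapping.lookup p \<gamma> else 0)"
    by (simp add: lookup_sum lookup_single when_def)
  show ?thesis
  proof (cases "\<exists>\<gamma>. \<alpha> = \<beta> + \<gamma>")
    case True
    then obtain \<gamma> where \<gamma>: "\<alpha> = \<beta> + \<gamma>" by blast
    then show ?thesis unfolding * by (auto simp: in_keys_iff)
  next
    case False
    then show ?thesis unfolding * by (auto intro!: sum.neutral)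
  qed
qed

lemma lookup_mon_poly_mult_add [simp]:
  "Poly_Mapping.lookup (mon_poly \<beta> * p) (\<beta> + \<gamma>) = Poly_Mapping.lookup p \<gamma>"
  by (auto simp: lookup_mon_poly_mult)

lemma keys_mon_poly_mult: "Poly_Mapping.keys (mon_poly \<beta> * p) = (+) \<beta> ` Poly_Mapping.keys p"
  by (auto simp: in_keys_iff lookup_mon_poly_mult image_iff split: if_splits)

lemma mon_poly_add: "mon_poly (\<alpha> + \<beta>) = mon_poly \<alpha> * mon_poly \<beta>"
  by (simp add: mon_poly_def mult_single)

lemma var_power: "var i ^ k = mon_poly (Poly_Mapping.single i k)"
proof (induction k)
  case 0
  then show ?case by (simp add: mon_poly_def)
next
  case (Suc k)
  have "Poly_Mapping.single i (Suc k) = var_mon i + Poly_Mapping.single i k"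
    by (simp add: var_mon_def flip: single_add)
  then show ?case using Suc by (simp add: mon_poly_add var_def)
qed

definition linear_form :: "nat \<Rightarrow> 'k::field mpoly" where
  "linear_form N = (\<Sum>i=1..N. var i)"

lemma exists_add_var_mon_iff:
  "(\<exists>\<gamma>. \<alpha> = var_mon i + \<gamma>) \<longleftrightarrow> Poly_Mapping.lookup \<alpha> i \<noteq> 0"
  using var_mon_add_minus[of \<alpha> i] by (auto simp: lookup_add lookup_var_mon) metis

text \<open>The bridge between the polynomial ring and the operators on coefficient
  functions.\<close>

lemma lookup_linear_form_mult:
  "Poly_Mapping.lookup (linear_form N * p) \<alpha> = raising N (Poly_Mapping.lookup p) \<alpha>"
  by (auto simp: linear_form_def sum_distrib_right lookup_sum raising_def var_def
      lookup_mon_poly_mult exists_add_var_mon_iff intro!: sum.cong)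

lemma linear_form_in_polys: "linear_form N \<in> polys N"
proof -
  have "Poly_Mapping.lookup (linear_form N) \<alpha> = 0" if "\<alpha> \<notin> monomials N" for \<alpha>
    using that var_mon_in_monomials[of _ N]
    by (auto simp: linear_form_def lookup_sum var_def lookup_mon_poly intro!: sum.neutral)
  then show ?thesis by (auto simp: polys_def in_keys_iff)
qed

section \<open>Ideals\<close>

lemma one_in_polys: "1 \<in> polys N"
  using mon_poly_in_polys[of 0 N] by (simp add: mon_poly_def monomials_def)

lemma zero_in_polys: "0 \<in> polys N"
  by (simp add: polys_def)

lemma add_in_polys: "p \<in> polys N \<Longrightarrow> q \<in> polys N \<Longrightarrow> p + q \<in> polys N"
  by (auto simp: polys_def in_keys_iff lookup_add) (metis add.right_neutral in_keys_iff subsetD)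

lemma diff_in_polys: "p \<in> polys N \<Longrightarrow> q \<in> polys N \<Longrightarrow> p - q \<in> polys N"
  by (auto simp: polys_def in_keys_iff lookup_minus) (metis diff_self in_keys_iff subsetD)

lemma sum_in_polys: "(\<And>x. x \<in> A \<Longrightarrow> f x \<in> polys N) \<Longrightarrow> sum f A \<in> polys N"
  by (induction A rule: infinite_finite_induct) (auto simp: zero_in_polys add_in_polys)

lemma mult_in_polys: "p \<in> polys N \<Longrightarrow> q \<in> polys N \<Longrightarrow> p * q \<in> polys N"
  using keys_mult[of p q] by (fastforce simp: polys_def add_in_monomials_iff)

lemma ideal_genI: "g \<in> G \<Longrightarrow> c \<in> polys N \<Longrightarrow> c * g \<in> ideal_gen N G"
  unfolding ideal_gen_def by (rule CollectI, rule exI[of _ "{g}"], rule exI[of _ "\<lambda>_. c"]) simp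

lemma ideal_genE:
  assumes "p \<in> ideal_gen N G"
  obtains F c where "p = (\<Sum>g\<in>F. c g * g)" "finite F" "F \<subseteq> G" "\<forall>g\<in>F. c g \<in> polys N"
  using assms by (auto simp: ideal_gen_def)

lemma ideal_gen_zero: "0 \<in> ideal_gen N G"
  unfolding ideal_gen_def by (rule CollectI, rule exI[of _ "{}"]) simp

lemma ideal_gen_add:
  assumes "p \<in> ideal_gen N G" "q \<in> ideal_gen N G"
  shows "p + q \<in> ideal_gen N G"
proof -
  obtain F c where F: "p = (\<Sum>g\<in>F. c g * g)" "finite F" "F \<subseteq> G" "\<forall>g\<in>F. c g \<in> polys N"
    using assms(1) by (rule ideal_genE)
  obtain F' c' where F': "q = (\<Sum>g\<in>F'. c' g * g)" "finite F'" "F' \<subseteq> G" "\<forall>g\<in>F'. c' g \<in> polys N"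
    using assms(2) by (rule ideal_genE)
  \<comment> \<open>Each generator carries a single coefficient, so both families are extended by
    zero to the union of their index sets and added there.\<close>
  let ?d = "\<lambda>g. (if g \<in> F then c g else 0) + (if g \<in> F' then c' g else 0)"
  have "p = (\<Sum>g\<in>F \<union> F'. (if g \<in> F then c g else 0) * g)"
    unfolding F(1) using F(2) F'(2) by (intro sum.mono_neutral_cong_left) auto
  moreover have "q = (\<Sum>g\<in>F \<union> F'. (if g \<in> F' then c' g else 0) * g)"
    unfolding F'(1) using F(2) F'(2) by (intro sum.mono_neutral_cong_left) auto
  ultimately have "p + q = (\<Sum>g\<in>F \<union> F'. ?d g * g)"
    by (simp add: sum.distrib distrib_right)
  moreover have "\<forall>g\<in>F \<union> F'. ?d g \<in> polys N"
    using F(4) F'(4) by (auto intro!: add_in_polys zero_in_polys)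
  ultimately show ?thesis
    unfolding ideal_gen_def using F(2,3) F'(2,3)
    by (intro CollectI exI[of _ "F \<union> F'"] exI[of _ ?d]) auto
qed

lemma ideal_gen_sum: "(\<And>x. x \<in> A \<Longrightarrow> f x \<in> ideal_gen N G) \<Longrightarrow> sum f A \<in> ideal_gen N G"
  by (induction A rule: infinite_finite_induct) (auto simp: ideal_gen_zero ideal_gen_add)

lemma ideal_gen_mult:
  assumes "p \<in> ideal_gen N G" "q \<in> polys N"
  shows "q * p \<in> ideal_gen N G"
proof -
  obtain F c where F: "p = (\<Sum>g\<in>F. c g * g)" "F \<subseteq> G" "\<forall>g\<in>F. c g \<in> polys N"
    using assms(1) by (rule ideal_genE)
  have "q * p = (\<Sum>g\<in>F. (q * c g) * g)"
    by (simp add: F(1) sum_distrib_left mult.assoc)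
  also have "\<dots> \<in> ideal_gen N G"
    using F assms(2) by (intro ideal_gen_sum ideal_genI mult_in_polys) auto
  finally show ?thesis .
qed

lemma ideal_gen_subset_polys: "G \<subseteq> polys N \<Longrightarrow> ideal_gen N G \<subseteq> polys N"
  by (auto simp: ideal_gen_def intro!: sum_in_polys mult_in_polys)

section \<open>Normal forms modulo the ideal\<close>

text \<open>Identifying m-free monomials with choice functions gives their finiteness and, later,
  the expansion of a product of sums.\<close>

lemma bij_betw_m_free:
  "bij_betw (\<lambda>\<alpha>. restrict (Poly_Mapping.lookup \<alpha>) {1..N}) (m_free N m)
     (PiE {1..N} (\<lambda>i. {..<m i}))"
proof (rule bij_betwI')
  fix \<alpha> \<beta> assume ab: "\<alpha> \<in> m_free N m" "\<beta> \<in> m_free N m"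
  show "(restrict (Poly_Mapping.lookup \<alpha>) {1..N} = restrict (Poly_Mapping.lookup \<beta>) {1..N}) = (\<alpha> = \<beta>)"
  proof
    assume eq: "restrict (Poly_Mapping.lookup \<alpha>) {1..N} = restrict (Poly_Mapping.lookup \<beta>) {1..N}"
    show "\<alpha> = \<beta>"
    proof (rule poly_mapping_eqI)
      fix i
      show "Poly_Mapping.lookup \<alpha> i = Poly_Mapping.lookup \<beta> i"
      proof (cases "i \<in> {1..N}")
        case True
        then show ?thesis using fun_cong[OF eq, of i] by simp
      next
        case False
        then have "i \<notin> Poly_Mapping.keys \<alpha>" "i \<notin> Poly_Mapping.keys \<beta>"
          using ab by (auto simp: m_free_def monomials_def)
        then show ?thesis by (simp add: in_keys_iff)
      qed
    qed
  qed simp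
next
  fix \<alpha> assume "\<alpha> \<in> m_free N m"
  then show "restrict (Poly_Mapping.lookup \<alpha>) {1..N} \<in> PiE {1..N} (\<lambda>i. {..<m i})"
    by (auto simp: m_free_def)
next
  fix g assume g: "g \<in> PiE {1..N} (\<lambda>i. {..<m i})"
  define \<alpha> where "\<alpha> = (\<Sum>i=1..N. Poly_Mapping.single i (g i))"
  have lookup: "Poly_Mapping.lookup \<alpha> i = (if i \<in> {1..N} then g i else 0)" for i
    by (simp add: \<alpha>_def lookup_sum lookup_single when_def)
  have "\<alpha> \<in> m_free N m"
    using g by (auto simp: m_free_def monomials_def in_keys_iff lookup split: if_splits)
  moreover have "g = restrict (Poly_Mapping.lookup \<alpha>) {1..N}"
    using PiE_arb[OF g] by (auto simp: lookup fun_eq_iff)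
  ultimately show "\<exists>\<alpha>\<in>m_free N m. g = restrict (Poly_Mapping.lookup \<alpha>) {1..N}"
    by blast
qed

lemma finite_m_free [simp]: "finite (m_free N m)"
  using bij_betw_finite[OF bij_betw_m_free[of N m]] by (simp add: finite_PiE)

lemma m_free_subset_monomials: "m_free N m \<subseteq> monomials N"
  by (auto simp: m_free_def)

lemma I1_eq: "I1 N m = ideal_gen N (insert (linear_form N) {var i ^ m i | i. i \<in> {1..N}})"
  by (simp add: I1_def linear_form_def)

lemma single_in_monomials: "i \<in> {1..N} \<Longrightarrow> Poly_Mapping.single i k \<in> monomials N"
  by (auto simp: monomials_def)

lemma I1_generators_in_polys:
  "insert (linear_form N) {var i ^ m i | i. i \<in> {1..N}} \<subseteq> polys N"
  by (auto simp: linear_form_in_polys var_power intro!: mon_poly_in_polys single_in_monomials)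

lemma I1_subset_polys: "I1 N m \<subseteq> polys N"
  unfolding I1_eq by (rule ideal_gen_subset_polys[OF I1_generators_in_polys])

text \<open>Multiples of \<open>var i ^ m i\<close> have no m-free monomials, so on these only the
  summand of the linear form survives; q is its coefficient.\<close>

lemma I1_imp_raising:
  assumes "p \<in> I1 N m"
  shows "\<exists>q. \<forall>\<alpha>\<in>m_free N m. Poly_Mapping.lookup p \<alpha> = raising N (Poly_Mapping.lookup q) \<alpha>"
proof -
  let ?G = "insert (linear_form N) {var i ^ m i | i. i \<in> {1..N}}"
  obtain F c where F: "p = (\<Sum>g\<in>F. c g * g)" "finite F" "F \<subseteq> ?G"
    using assms unfolding I1_eq by (rule ideal_genE)
  define q where "q = (if linear_form N \<in> F then c (linear_form N) else 0)"
  have "Poly_Mapping.lookup p \<alpha> = raising N (Poly_Mapping.lookup q) \<alpha>" if \<alpha>: "\<alpha> \<in> m_free N m" for \<alpha>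
  proof -
    have "Poly_Mapping.lookup (c g * g) \<alpha> = (if g = linear_form N then raising N (Poly_Mapping.lookup q) \<alpha> else 0)"
      if "g \<in> F" for g
    proof (cases "g = linear_form N")
      case True
      then show ?thesis
        using that by (simp add: q_def mult.commute[of _ "linear_form N"] lookup_linear_form_mult)
    next
      case False
      then obtain i where i: "i \<in> {1..N}" "g = var i ^ m i"
        using F(3) \<open>g \<in> F\<close> by blast
      have "\<alpha> \<noteq> Poly_Mapping.single i (m i) + \<gamma>" for \<gamma>
      proof
        assume "\<alpha> = Poly_Mapping.single i (m i) + \<gamma>"
        then have "Poly_Mapping.lookup \<alpha> i \<ge> m i" by (simp add: lookup_add)
        then show False using \<alpha> i(1) by (force simp: m_free_def)
      qed
      then show ?thesis
        using False by (simp add: i(2) var_power mult.commute[of "c _"] lookup_mon_poly_mult)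
    qed
    then have "Poly_Mapping.lookup p \<alpha> = (\<Sum>g\<in>F. if g = linear_form N then raising N (Poly_Mapping.lookup q) \<alpha> else 0)"
      by (simp add: F(1) lookup_sum)
    also have "\<dots> = raising N (Poly_Mapping.lookup q) \<alpha>"
      using F(2) raising_zero by (auto simp: q_def zero_poly_mapping.rep_eq)
    finally show ?thesis .
  qed
  then show ?thesis by blast
qed

text \<open>The converse test: the difference u of p and the multiple of the linear form has no
  m-free monomials, so each of its terms is divisible by some \<open>var i ^ m i\<close>.\<close>

lemma I1_if_raising:
  assumes "p \<in> polys N" "q \<in> polys N"
    and "\<And>\<alpha>. \<alpha> \<in> m_free N m \<Longrightarrow> Poly_Mapping.lookup p \<alpha> = raising N (Poly_Mapping.lookup q) \<alpha>"
  shows "p \<in> I1 N m"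
proof -
  define u where "u = p - q * linear_form N"
  have u: "u \<in> polys N"
    using assms(1,2) by (simp add: u_def diff_in_polys mult_in_polys linear_form_in_polys)
  have u0: "Poly_Mapping.lookup u \<alpha> = 0" if "\<alpha> \<in> m_free N m" for \<alpha>
    using assms(3)[OF that]
    by (simp add: u_def lookup_minus mult.commute[of q] lookup_linear_form_mult)
  have "Poly_Mapping.single \<alpha> (Poly_Mapping.lookup u \<alpha>) \<in> I1 N m" if "\<alpha> \<in> Poly_Mapping.keys u" for \<alpha>
  proof -
    have \<alpha>: "\<alpha> \<in> monomials N" "\<alpha> \<notin> m_free N m"
      using that u u0 by (auto simp: polys_def in_keys_iff)
    then obtain i where i: "i \<in> {1..N}" "Poly_Mapping.lookup \<alpha> i \<ge> m i"
      by (auto simp: m_free_def not_less)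
    define \<beta> where "\<beta> = \<alpha> - Poly_Mapping.single i (m i)"
    have "\<beta> + Poly_Mapping.single i (m i) = \<alpha>"
      using i(2) by (intro poly_mapping_eqI)
        (auto simp: \<beta>_def lookup_add lookup_minus lookup_single when_def)
    then have "Poly_Mapping.single \<alpha> (Poly_Mapping.lookup u \<alpha>) =
        Poly_Mapping.single \<beta> (Poly_Mapping.lookup u \<alpha>) * var i ^ m i" and "\<beta> \<in> monomials N"
      using \<alpha>(1) add_in_monomials_iff by (auto simp: var_power mon_poly_def mult_single)
    then show ?thesis
      unfolding I1_eq using i(1) by (auto simp: polys_def intro!: ideal_genI)
  qed
  then have "(\<Sum>\<alpha>\<in>Poly_Mapping.keys u. Poly_Mapping.single \<alpha> (Poly_Mapping.lookup u \<alpha>)) \<in> I1 N m"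
    unfolding I1_eq by (rule ideal_gen_sum)
  then have "u \<in> I1 N m"
    by (simp flip: poly_mapping_eq_sum_single)
  moreover have "q * linear_form N \<in> I1 N m"
    unfolding I1_eq using assms(2) by (intro ideal_genI) auto
  moreover have "p = u + q * linear_form N" by (simp add: u_def)
  ultimately show ?thesis by (simp add: I1_eq ideal_gen_add)
qed

section \<open>Initial monomials\<close>

lemma monomial_order_antisym:
  "monomial_order N r \<Longrightarrow> (\<alpha>, \<beta>) \<in> r \<Longrightarrow> (\<beta>, \<alpha>) \<in> r \<Longrightarrow> \<alpha> = \<beta>"
  by (auto simp: monomial_order_def well_order_on_def linear_order_on_def partial_order_on_def
      dest: antisymD)

lemma monomial_order_trans:
  "monomial_order N r \<Longrightarrow> (\<alpha>, \<beta>) \<in> r \<Longrightarrow> (\<beta>, \<gamma>) \<in> r \<Longrightarrow> (\<alpha>, \<gamma>) \<in> r"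
  by (auto simp: monomial_order_def well_order_on_def linear_order_on_def partial_order_on_def
      preorder_on_def dest: transD)

lemma monomial_order_total:
  "monomial_order N r \<Longrightarrow> \<alpha> \<in> monomials N \<Longrightarrow> \<beta> \<in> monomials N \<Longrightarrow> (\<alpha>, \<beta>) \<in> r \<or> (\<beta>, \<alpha>) \<in> r"
  by (cases "\<alpha> = \<beta>")
    (auto simp: monomial_order_def well_order_on_def linear_order_on_def partial_order_on_def
      preorder_on_def refl_on_def total_on_def)

lemma monomial_order_exists_max:
  assumes "monomial_order N r" "finite A" "A \<noteq> {}" "A \<subseteq> monomials N"
  shows "\<exists>\<alpha>\<in>A. \<forall>\<beta>\<in>A. (\<beta>, \<alpha>) \<in> r"
  using assms(2-4)
proof (induction A rule: finite_ne_induct)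
  case (singleton \<alpha>)
  then show ?case using monomial_order_total[OF assms(1), of \<alpha> \<alpha>] by auto
next
  case (insert \<gamma> A)
  then obtain \<alpha> where \<alpha>: "\<alpha> \<in> A" "\<forall>\<beta>\<in>A. (\<beta>, \<alpha>) \<in> r" by auto
  have "(\<gamma>, \<alpha>) \<in> r \<or> (\<alpha>, \<gamma>) \<in> r" "(\<gamma>, \<gamma>) \<in> r"
    using monomial_order_total[OF assms(1)] insert.prems \<alpha>(1) by auto
  then show ?case using \<alpha> monomial_order_trans[OF assms(1)] by blast
qed

lemma initial_monomial_eqI:
  assumes "monomial_order N r" "\<alpha> \<in> Poly_Mapping.keys p"
    and "\<And>\<beta>. \<beta> \<in> Poly_Mapping.keys p \<Longrightarrow> (\<beta>, \<alpha>) \<in> r"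
  shows "initial_monomial r p = \<alpha>"
  unfolding initial_monomial_def
  using assms monomial_order_antisym[OF assms(1)] by (intro the_equality) blast+

lemma initial_monomial:
  assumes "monomial_order N r" "p \<in> polys N" "p \<noteq> 0"
  shows "initial_monomial r p \<in> Poly_Mapping.keys p"
    and "\<And>\<beta>. \<beta> \<in> Poly_Mapping.keys p \<Longrightarrow> (\<beta>, initial_monomial r p) \<in> r"
proof -
  obtain \<alpha> where "\<alpha> \<in> Poly_Mapping.keys p" "\<forall>\<beta>\<in>Poly_Mapping.keys p. (\<beta>, \<alpha>) \<in> r"
    using monomial_order_exists_max[OF assms(1), of "Poly_Mapping.keys p"] assms(2,3)
    by (auto simp: polys_def)
  then show "initial_monomial r p \<in> Poly_Mapping.keys p"
    and "\<And>\<beta>. \<beta> \<in> Poly_Mapping.keys p \<Longrightarrow> (\<beta>, initial_monomial r p) \<in> r"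
    using initial_monomial_eqI[OF assms(1), of \<alpha> p] by auto
qed

lemma mon_poly_in_initial_ideal:
  "p \<in> I \<Longrightarrow> p \<noteq> 0 \<Longrightarrow> mon_poly (initial_monomial r p) \<in> initial_ideal N r I"
  unfolding initial_ideal_def
  using ideal_genI[OF _ one_in_polys,
      of "mon_poly (initial_monomial r p)" "{mon_poly (initial_monomial r p) | p. p \<in> I \<and> p \<noteq> 0}" N]
  by auto

text \<open>Comparing coefficients at \<alpha> shows that \<alpha> is divisible by the initial
  monomial of some element p of the ideal. Multiplying p by the cofactor stays in the ideal, and
  compatibility of the order with multiplication makes \<alpha> the initial monomial of the
  product.\<close>

lemma in_initial_idealD:
  fixes G :: "'k::field mpoly set"
  assumes ord: "monomial_order N r" and G: "G \<subseteq> polys N"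
    and \<alpha>: "\<alpha> \<in> monomials N" "mon_poly \<alpha> \<in> initial_ideal N r (ideal_gen N G)"
  obtains p where "p \<in> ideal_gen N G" "p \<noteq> 0" "initial_monomial r p = \<alpha>"
proof -
  obtain F c where F: "(mon_poly \<alpha> :: 'k mpoly) = (\<Sum>g\<in>F. c g * g)" "finite F"
    "F \<subseteq> {mon_poly (initial_monomial r p) | p. p \<in> ideal_gen N G \<and> p \<noteq> 0}" "\<forall>g\<in>F. c g \<in> polys N"
    using \<alpha>(2) unfolding initial_ideal_def by (rule ideal_genE)
  have "(\<Sum>g\<in>F. Poly_Mapping.lookup (c g * g) \<alpha>) \<noteq> 0"
    using arg_cong[OF F(1), of "\<lambda>p. Poly_Mapping.lookup p \<alpha>"] by (simp add: lookup_mon_poly lookup_sum)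
  then obtain g where g: "g \<in> F" "Poly_Mapping.lookup (c g * g) \<alpha> \<noteq> 0"
    by (meson sum.neutral)
  then obtain p where p: "p \<in> ideal_gen N G" "p \<noteq> 0" "g = mon_poly (initial_monomial r p)"
    using F(3) by auto
  then obtain \<gamma> where \<gamma>: "\<alpha> = initial_monomial r p + \<gamma>"
    using g(2) by (auto simp: mult.commute[of "c _"] lookup_mon_poly_mult split: if_splits)
  have \<gamma>_mon: "\<gamma> \<in> monomials N"
    using \<alpha>(1) \<gamma> add_in_monomials_iff by auto
  have p_polys: "p \<in> polys N"
    using p(1) ideal_gen_subset_polys[OF G] by auto
  note init = initial_monomial[OF ord p_polys p(2)]
  let ?q = "mon_poly \<gamma> * p"
  have "?q \<in> ideal_gen N G"
    using p(1) \<gamma>_mon by (intro ideal_gen_mult mon_poly_in_polys)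
  moreover have "Poly_Mapping.keys ?q \<noteq> {}"
    using init(1) by (auto simp: keys_mon_poly_mult)
  then have "?q \<noteq> 0" by auto
  moreover have "initial_monomial r ?q = \<alpha>"
  proof (rule initial_monomial_eqI[OF ord])
    show "\<alpha> \<in> Poly_Mapping.keys ?q"
      using init(1) by (auto simp: keys_mon_poly_mult \<gamma> add.commute)
  next
    fix \<beta> assume "\<beta> \<in> Poly_Mapping.keys ?q"
    then obtain \<delta> where "\<delta> \<in> Poly_Mapping.keys p" "\<beta> = \<gamma> + \<delta>"
      by (auto simp: keys_mon_poly_mult)
    then show "(\<beta>, \<alpha>) \<in> r"
      using init(2)[of \<delta>] \<gamma>_mon ord
      by (fastforce simp: monomial_order_def \<gamma> add.commute[of \<gamma>])
  qed
  ultimately show ?thesis by (rule that)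
qed

section \<open>Counting standard monomials\<close>

text \<open>Scalars act as constant polynomials; this supplies the vector space structure needed for
  counting dimensions.\<close>

definition scale :: "'k::field \<Rightarrow> 'k mpoly \<Rightarrow> 'k mpoly" where
  "scale c p = Poly_Mapping.single 0 c * p"

lemma lookup_scale: "Poly_Mapping.lookup (scale c p) \<alpha> = c * Poly_Mapping.lookup p \<alpha>"
  by (simp add: scale_def lookup_mult lookup_single when_mult)

interpretation mpoly: vector_space "scale :: 'k::field \<Rightarrow> _"
  by unfold_locales
    (auto intro!: poly_mapping_eqI simp: lookup_scale lookup_add algebra_simps)

definition restrict_poly :: "monomial set \<Rightarrow> 'k::field mpoly \<Rightarrow> 'k mpoly" where
  "restrict_poly A p = (\<Sum>\<alpha>\<in>Poly_Mapping.keys p \<inter> A. Poly_Mapping.single \<alpha> (Poly_Mapping.lookup p \<alpha>))"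

lemma lookup_restrict_poly:
  "Poly_Mapping.lookup (restrict_poly A p) \<alpha> = (if \<alpha> \<in> A then Poly_Mapping.lookup p \<alpha> else 0)"
  by (auto simp: restrict_poly_def lookup_sum lookup_single when_def in_keys_iff)

lemma restrict_poly_in_polys:
  assumes "A \<subseteq> monomials N"
  shows "restrict_poly A p \<in> polys N"
  using assms by (auto simp: polys_def in_keys_iff lookup_restrict_poly split: if_splits)

lemma mon_poly_inject [simp]: "mon_poly \<alpha> = (mon_poly \<beta> :: 'k::field mpoly) \<longleftrightarrow> \<alpha> = \<beta>"
  by (metis lookup_mon_poly zero_neq_one)

lemma sum_scale_mon_poly:
  assumes "finite A" "Poly_Mapping.keys p \<subseteq> A"
  shows "p = (\<Sum>\<alpha>\<in>A. scale (Poly_Mapping.lookup p \<alpha>) (mon_poly \<alpha>))"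
  using poly_mapping_eq_sum_single[OF assms] by (simp add: scale_def mon_poly_def mult_single)

lemma span_mon_poly:
  assumes "finite A"
  shows "mpoly.span (mon_poly ` A) = {p :: 'k::field mpoly. Poly_Mapping.keys p \<subseteq> A}"
proof (intro equalityI subsetI)
  fix p :: "'k mpoly" assume "p \<in> mpoly.span (mon_poly ` A)"
  then show "p \<in> {p. Poly_Mapping.keys p \<subseteq> A}"
  proof (induction rule: mpoly.span_induct_alt)
    case base
    then show ?case by simp
  next
    case (step c x y)
    then show ?case by (force simp: in_keys_iff lookup_add lookup_scale lookup_mon_poly split: if_splits)
  qed
next
  fix p :: "'k mpoly" assume "p \<in> {p. Poly_Mapping.keys p \<subseteq> A}"
  then show "p \<in> mpoly.span (mon_poly ` A)"
    using sum_scale_mon_poly[OF assms, of p]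
    by (metis (no_types, lifting) imageI mem_Collect_eq mpoly.span_base mpoly.span_scale mpoly.span_sum)
qed

lemma independent_mon_poly:
  assumes "finite A"
  shows "mpoly.independent (mon_poly ` A :: 'k::field mpoly set)"
proof (rule mpoly.independent_if_scalars_zero)
  fix f :: "'k mpoly \<Rightarrow> 'k" and x :: "'k mpoly"
  assume 0: "(\<Sum>x\<in>mon_poly ` A. scale (f x) x) = 0" and "x \<in> mon_poly ` A"
  then obtain \<alpha> where \<alpha>: "\<alpha> \<in> A" "x = mon_poly \<alpha>" by blast
  have "(\<Sum>\<beta>\<in>A. scale (f (mon_poly \<beta>)) (mon_poly \<beta>)) = 0"
    using 0 by (simp add: sum.reindex inj_on_def)
  from arg_cong[OF this, of "\<lambda>p. Poly_Mapping.lookup p \<alpha>"] show "f x = 0"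
    using \<alpha> assms by (simp add: lookup_sum lookup_scale lookup_mon_poly if_distrib cong: if_cong)
qed (use assms in simp)

text \<open>A set of exponent vectors does not mention the coefficient field, so the
  \<open>itself\<close> argument fixes it.\<close>

definition standard_monomials ::
    "nat \<Rightarrow> monomial rel \<Rightarrow> (nat \<Rightarrow> nat) \<Rightarrow> 'k::field itself \<Rightarrow> monomial set" where
  "standard_monomials N r m _ =
     {\<alpha> \<in> m_free N m. mon_poly \<alpha> \<notin> initial_ideal N r (I1 N m :: 'k mpoly set)}"

text \<open>The bound on d is the hypothesis of \<open>raising_injective\<close> for degree d - 1.
  Writing \<open>Suc (mdegree \<alpha>) = d\<close> makes the lower set empty for d = 0.\<close>

theorem card_standard_monomials:
  fixes N d :: nat and m :: "nat \<Rightarrow> nat"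
  assumes ord: "monomial_order N r"
    and d: "2 * int d < (\<Sum>i=1..N. int (m i) - 1) + 2"
  shows "card {\<alpha> \<in> standard_monomials N r m TYPE('k::field_char_0). mdegree \<alpha> = d}
      + card {\<alpha> \<in> m_free N m. Suc (mdegree \<alpha>) = d}
    = card {\<alpha> \<in> m_free N m. mdegree \<alpha> = d}"
proof -
  define I where "I = (I1 N m :: 'k mpoly set)"
  define S where "S = {\<alpha> \<in> m_free N m. mdegree \<alpha> = d}"
  define S' where "S' = {\<alpha> \<in> m_free N m. Suc (mdegree \<alpha>) = d}"
  define T where "T = {\<alpha> \<in> standard_monomials N r m TYPE('k). mdegree \<alpha> = d}"
  have T: "T = {\<alpha> \<in> S. mon_poly \<alpha> \<notin> initial_ideal N r I}"
    by (auto simp: T_def S_def I_def standard_monomials_def)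
  have fin: "finite S" "finite S'" "finite T"
    using T by (auto simp: S_def S'_def)
  have disj: "T \<inter> S' = {}" by (auto simp: T_def S'_def)
  have sub: "S \<subseteq> monomials N" "S' \<subseteq> monomials N" "T \<subseteq> S" "S \<subseteq> m_free N m"
    using m_free_subset_monomials T by (auto simp: S_def S'_def)
  \<comment> \<open>\<phi> is the inclusion on the span of T plus multiplication by the linear form
    on the span of S', projected to S. As T and S' lie in different degrees, a polynomial supported
    on T \<union> S' encodes a pair. The count follows once \<phi> is a bijection onto the span of
    S.\<close>
  define \<phi> where "\<phi> p = restrict_poly T p + restrict_poly S (linear_form N * restrict_poly S' p)"
    for p :: "'k mpoly"
  have lookup_\<phi>: "Poly_Mapping.lookup (\<phi> p) \<alpha> = (if \<alpha> \<in> T then Poly_Mapping.lookup p \<alpha> else 0)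
      + (if \<alpha> \<in> S then raising N (Poly_Mapping.lookup (restrict_poly S' p)) \<alpha> else 0)" for p \<alpha>
    by (simp add: \<phi>_def lookup_add lookup_restrict_poly lookup_linear_form_mult)
  have raising_restrict: "raising N (Poly_Mapping.lookup (restrict_poly S' p)) \<alpha> =
      (\<Sum>i=1..N. if Poly_Mapping.lookup \<alpha> i \<noteq> 0 \<and> \<alpha> - var_mon i \<in> S'
        then Poly_Mapping.lookup p (\<alpha> - var_mon i) else 0)" for p \<alpha>
    by (auto simp: raising_def lookup_restrict_poly intro!: sum.cong)
  interpret \<phi>: Vector_Spaces.linear scale scale \<phi>
  proof (unfold_locales)
    show "\<phi> (p + q) = \<phi> p + \<phi> q" for p q
      by (rule poly_mapping_eqI)
        (auto simp: lookup_\<phi> lookup_add raising_restrict simp flip: sum.distrib intro!: sum.cong)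
    show "\<phi> (scale c p) = scale c (\<phi> p)" for c p
      by (rule poly_mapping_eqI)
        (auto simp: lookup_\<phi> lookup_scale raising_restrict sum_distrib_left distrib_left intro!: sum.cong)
  qed
  have inj: "p = 0" if p: "Poly_Mapping.keys p \<subseteq> T \<union> S'" and 0: "\<phi> p = 0" for p
  proof -
    define q where "q = restrict_poly T p"
    define p' where "p' = restrict_poly S' p"
    have p_eq: "p = q + p'"
      using p disj by (intro poly_mapping_eqI)
        (auto simp: q_def p'_def lookup_add lookup_restrict_poly in_keys_iff subset_iff)
    have q_polys: "q \<in> polys N" "p' \<in> polys N"
      unfolding q_def p'_def using sub by (auto intro!: restrict_poly_in_polys)
    \<comment> \<open>The product of the linear form with p' is homogeneous of degree d, so the
      projection to S loses nothing on m-free monomials.\<close>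
    have hom: "raising N (Poly_Mapping.lookup p') \<alpha> = 0" if "\<alpha> \<notin> S" "\<alpha> \<in> m_free N m" for \<alpha>
    proof -
      have "\<alpha> - var_mon i \<notin> S'" if "Poly_Mapping.lookup \<alpha> i \<noteq> 0" for i
      proof
        assume "\<alpha> - var_mon i \<in> S'"
        moreover have "mdegree \<alpha> = Suc (mdegree (\<alpha> - var_mon i))"
          using mdegree_add[of "var_mon i" "\<alpha> - var_mon i"] var_mon_add_minus[of \<alpha> i] that by simp
        ultimately show False
          using \<open>\<alpha> \<notin> S\<close> \<open>\<alpha> \<in> m_free N m\<close> by (simp add: S_def S'_def)
      qed
      then show ?thesis
        by (auto simp: raising_def p'_def lookup_restrict_poly intro!: sum.neutral)
    qed
    have eq: "Poly_Mapping.lookup (- q) \<alpha> = raising N (Poly_Mapping.lookup p') \<alpha>"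
      if "\<alpha> \<in> m_free N m" for \<alpha>
      using arg_cong[OF 0, of "\<lambda>p. Poly_Mapping.lookup p \<alpha>"] hom[OF _ that] sub(3)
      by (auto simp: lookup_\<phi> p'_def q_def lookup_restrict_poly add_eq_0_iff split: if_splits)
    \<comment> \<open>A nonzero -q would lie in I while its initial monomial is in T, that is,
      standard.\<close>
    have q0: "- q = 0"
    proof (rule ccontr)
      assume nz: "- q \<noteq> 0"
      have nq: "- q \<in> polys N"
        using diff_in_polys[OF zero_in_polys q_polys(1)] by simp
      then have "- q \<in> I"
        unfolding I_def using q_polys(2) eq by (rule I1_if_raising)
      then have "mon_poly (initial_monomial r (- q)) \<in> initial_ideal N r I"
        using nz by (rule mon_poly_in_initial_ideal)
      moreover have "initial_monomial r (- q) \<in> T"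
        using initial_monomial(1)[OF ord nq nz]
        by (auto simp: in_keys_iff q_def lookup_restrict_poly split: if_splits)
      ultimately show False by (simp add: T)
    qed
    have "Poly_Mapping.lookup p' \<alpha> = 0" if "\<alpha> \<in> m_free N m" for \<alpha>
    proof (cases d)
      case 0
      then show ?thesis by (simp add: p'_def lookup_restrict_poly S'_def)
    next
      case (Suc e)
      show ?thesis
      proof (rule raising_injective[OF _ _ _ that])
        show "Poly_Mapping.lookup p' \<beta> = 0" if "mdegree \<beta> \<noteq> e" for \<beta>
          using that Suc by (simp add: p'_def lookup_restrict_poly S'_def)
        show "2 * int e < (\<Sum>i=1..N. int (m i) - 1)" using d Suc by simp
        show "raising N (Poly_Mapping.lookup p') \<beta> = 0" if "\<beta> \<in> m_free N m" for \<beta>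
          using eq[OF that] q0 by simp
      qed
    qed
    moreover have "Poly_Mapping.lookup p' \<alpha> = 0" if "\<alpha> \<notin> m_free N m" for \<alpha>
      using that by (simp add: p'_def lookup_restrict_poly S'_def)
    ultimately have "p' = 0"
      by (intro poly_mapping_eqI) (metis lookup_zero)
    then show ?thesis using p_eq q0 by simp
  qed
  \<comment> \<open>Modulo monomials that are not m-free, p is a multiple of the linear form; in
    degree d only the part of the cofactor supported on S' matters.\<close>
  have restrict_I: "restrict_poly S p \<in> \<phi> ` mpoly.span (mon_poly ` (T \<union> S'))" if "p \<in> I" for p
  proof -
    obtain q where q: "\<And>\<alpha>. \<alpha> \<in> m_free N m \<Longrightarrow>
        Poly_Mapping.lookup p \<alpha> = raising N (Poly_Mapping.lookup q) \<alpha>"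
      using I1_imp_raising[of p N m] \<open>p \<in> I\<close> unfolding I_def by blast
    let ?q = "restrict_poly S' q"
    have "raising N (Poly_Mapping.lookup q) \<alpha> = raising N (Poly_Mapping.lookup ?q) \<alpha>"
      if "\<alpha> \<in> S" for \<alpha>
      unfolding raising_def
    proof (intro sum.cong refl if_cong)
      fix i assume "Poly_Mapping.lookup \<alpha> i \<noteq> 0"
      then have *: "(\<alpha> - var_mon i) + var_mon i = \<alpha>"
        using var_mon_add_minus[of \<alpha> i] by (simp add: add.commute)
      then have "\<alpha> - var_mon i \<in> S'"
        using that mdegree_add[of "\<alpha> - var_mon i" "var_mon i"]
          m_free_leD[of "\<alpha> - var_mon i" "var_mon i" N m]
        by (auto simp: S_def S'_def)
      then show "Poly_Mapping.lookup q (\<alpha> - var_mon i) = Poly_Mapping.lookup ?q (\<alpha> - var_mon i)"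
        by (simp add: lookup_restrict_poly)
    qed
    moreover have "restrict_poly S' ?q = ?q"
      by (rule poly_mapping_eqI) (simp add: lookup_restrict_poly)
    ultimately have "restrict_poly S p = \<phi> ?q"
      using q sub disj by (intro poly_mapping_eqI) (auto simp: lookup_\<phi> lookup_restrict_poly)
    moreover have "?q \<in> mpoly.span (mon_poly ` (T \<union> S'))"
      using fin by (auto simp: span_mon_poly in_keys_iff lookup_restrict_poly split: if_splits)
    ultimately show ?thesis by blast
  qed
  let ?W = "\<phi> ` mpoly.span (mon_poly ` (T \<union> S'))"
  have W: "mpoly.subspace ?W"
    by (intro \<phi>.subspace_image mpoly.subspace_span)
  \<comment> \<open>Surjectivity by reduction along the well-order: a standard monomial is fixed by
    \<phi>, and a nonstandard one is the initial monomial of some p in I, hence expressible through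
    \<open>restrict_poly S p\<close> and smaller monomials.\<close>
  have "wf (r - Id)"
    using ord by (simp add: monomial_order_def well_order_on_def)
  then have "\<alpha> \<in> S \<longrightarrow> mon_poly \<alpha> \<in> ?W" for \<alpha>
  proof (induction \<alpha>)
    case (less \<alpha>)
    show ?case
    proof
      assume \<alpha>: "\<alpha> \<in> S"
      show "mon_poly \<alpha> \<in> ?W"
      proof (cases "\<alpha> \<in> T")
        case True
        have "mon_poly \<alpha> = \<phi> (mon_poly \<alpha>)"
          using True disj sub(3) by (intro poly_mapping_eqI)
            (auto simp: lookup_\<phi> lookup_mon_poly raising_restrict intro!: sum.neutral)
        moreover have "mon_poly \<alpha> \<in> mpoly.span (mon_poly ` (T \<union> S'))"
          using True by (intro mpoly.span_base) simp
        ultimately show ?thesis by (rule image_eqI)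
      next
        case False
        then have "mon_poly \<alpha> \<in> initial_ideal N r I" using \<alpha> T by simp
        then obtain p where p: "p \<in> I" "p \<noteq> 0" "initial_monomial r p = \<alpha>"
          using in_initial_idealD[OF ord I1_generators_in_polys] \<alpha> sub(1)
          unfolding I_def I1_eq by blast
        note init = initial_monomial[OF ord _ p(2), unfolded p(3)]
        have p_polys: "p \<in> polys N" using p(1) I1_subset_polys by (auto simp: I_def)
        let ?c = "Poly_Mapping.lookup p"
        have c: "?c \<alpha> \<noteq> 0" using init(1)[OF p_polys] by (simp add: in_keys_iff)
        \<comment> \<open>The projection drops terms of other degrees or outside the m-free
          monomials but keeps \<alpha>, so p may be inhomogeneous.\<close>
        have "restrict_poly S p = (\<Sum>\<beta>\<in>S. scale (?c \<beta>) (mon_poly \<beta>))"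
          using sum_scale_mon_poly[OF fin(1), of "restrict_poly S p"]
          by (simp add: in_keys_iff subset_iff lookup_restrict_poly)
        also have "\<dots> = scale (?c \<alpha>) (mon_poly \<alpha>) + (\<Sum>\<beta>\<in>S - {\<alpha>}. scale (?c \<beta>) (mon_poly \<beta>))"
          using fin(1) \<alpha> by (rule sum.remove)
        finally have eq: "scale (?c \<alpha>) (mon_poly \<alpha>) =
            restrict_poly S p - (\<Sum>\<beta>\<in>S - {\<alpha>}. scale (?c \<beta>) (mon_poly \<beta>))"
          by (simp add: algebra_simps)
        have "scale (?c \<beta>) (mon_poly \<beta>) \<in> ?W" if "\<beta> \<in> S - {\<alpha>}" for \<beta>
        proof (cases "?c \<beta> = 0")
          case True
          then show ?thesis using mpoly.subspace_0[OF W] by simp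
        next
          case False
          then have "(\<beta>, \<alpha>) \<in> r - Id"
            using init(2)[OF p_polys, of \<beta>] that by (simp add: in_keys_iff)
          then show ?thesis using less.IH that mpoly.subspace_scale[OF W] by blast
        qed
        then have "scale (?c \<alpha>) (mon_poly \<alpha>) \<in> ?W"
          unfolding eq using restrict_I[OF p(1)]
          by (intro mpoly.subspace_diff[OF W] mpoly.subspace_sum[OF W])
        from mpoly.subspace_scale[OF W this, of "inverse (?c \<alpha>)"] show ?thesis
          using c by simp
      qed
    qed
  qed
  then have "mpoly.span (mon_poly ` S) \<subseteq> ?W"
    by (intro mpoly.span_minimal[OF _ W]) auto
  moreover have "?W \<subseteq> mpoly.span (mon_poly ` S)"
    using sub(3) fin by (auto simp: span_mon_poly in_keys_iff lookup_\<phi> split: if_splits)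
  ultimately have W_eq: "mpoly.span (\<phi> ` mon_poly ` (T \<union> S')) = mpoly.span (mon_poly ` S)"
    by (simp add: \<phi>.span_image)
  have inj_on: "inj_on \<phi> (mpoly.span (mon_poly ` (T \<union> S')))"
    using inj fin by (subst \<phi>.inj_on_iff_eq_0[OF mpoly.subspace_span]) (auto simp: span_mon_poly)
  \<comment> \<open>Two independent sets with the same span: the image of the monomials in T
    \<union> S', and the monomials in S.\<close>
  have "mpoly.independent (\<phi> ` mon_poly ` (T \<union> S'))"
    using fin inj_on by (intro \<phi>.independent_injective_image independent_mon_poly) simp_all
  then have "card (\<phi> ` mon_poly ` (T \<union> S')) = card (mon_poly ` S :: 'k mpoly set)"
    using mpoly.dim_eq_card[OF W_eq] mpoly.dim_eq_card_independent[OF independent_mon_poly[OF fin(1), where 'k = 'k]]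
    by simp
  also have "card (\<phi> ` mon_poly ` (T \<union> S')) = card (T \<union> S')"
    using inj_on_subset[OF inj_on mpoly.span_superset]
    by (subst card_image) (auto simp: card_image inj_on_def)
  also have "card (mon_poly ` S :: 'k mpoly set) = card S"
    by (simp add: card_image inj_on_def)
  finally show ?thesis
    using card_Un_disjoint[OF fin(3,2) disj] by (simp add: T_def S_def S'_def)
qed

section \<open>\<open>s\<close>-binomial coefficients\<close>

lemma prod_monom_one:
  "(\<Prod>i\<in>A. monom (1 :: 'a::comm_semiring_1) (f i)) = monom 1 (\<Sum>i\<in>A. f i)"
  by (induction A rule: infinite_finite_induct) (simp_all add: mult_monom)

text \<open>Expanding the power picks one exponent at most s from each of the N factors; such
  choices are the m-free monomials, and the exponents add up to the degree.\<close>

lemma s_binomial_eq_card: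
  "s_binomial s N (int d) = int (card {\<alpha> \<in> m_free N (\<lambda>_. Suc s). mdegree \<alpha> = d})"
proof -
  let ?M = "m_free N (\<lambda>_. Suc s)"
  have "(\<Sum>i\<le>s. monom (1::int) i) ^ N = (\<Prod>i\<in>{1..N}. \<Sum>j\<in>{..<Suc s}. monom 1 j)"
    by (simp add: lessThan_Suc_atMost)
  also have "\<dots> = (\<Sum>g\<in>PiE {1..N} (\<lambda>_. {..<Suc s}). \<Prod>i\<in>{1..N}. monom 1 (g i))"
    by (rule prod_sum_PiE) auto
  also have "\<dots> = (\<Sum>g\<in>PiE {1..N} (\<lambda>_. {..<Suc s}). monom 1 (\<Sum>i\<in>{1..N}. g i))"
    by (simp only: prod_monom_one)
  also have "\<dots> = (\<Sum>\<alpha>\<in>?M. monom 1 (\<Sum>i\<in>{1..N}. restrict (Poly_Mapping.lookup \<alpha>) {1..N} i))"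
    by (rule sum.reindex_bij_betw[OF bij_betw_m_free, symmetric])
  also have "\<dots> = (\<Sum>\<alpha>\<in>?M. monom 1 (mdegree \<alpha>))"
    by (intro sum.cong refl) (auto simp: m_free_def mdegree_eq_sum[where N = N])
  finally have "s_binomial s N (int d) = (\<Sum>\<alpha>\<in>?M. if mdegree \<alpha> = d then 1 else 0)"
    by (simp add: s_binomial_def coeff_sum)
  also have "\<dots> = int (card {\<alpha> \<in> ?M. mdegree \<alpha> = d})"
    by (simp add: Int_def flip: sum.inter_filter)
  finally show ?thesis .
qed

text \<open>The polynomial 1 + x + ... + x^s is palindromic, hence so are its powers. Outside the
  range from 0 to s N both sides are zero, so d may be any integer.\<close>

lemma s_binomial_symmetric: "s_binomial s N (int s * int N - d) = s_binomial s N d"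
proof -
  let ?p = "\<Sum>i\<le>s. monom (1::int) i"
  have coeff: "coeff ?p j = (if j \<le> s then 1 else 0)" for j
    by (simp add: coeff_sum)
  have deg: "degree ?p = s"
    by (rule antisym[OF degree_le le_degree]) (simp_all add: coeff)
  have nz: "?p \<noteq> 0"
    using coeff[of 0] by force
  have "reflect_poly ?p = ?p"
    by (rule poly_eqI) (simp only: coeff_reflect_poly deg coeff, simp)
  then have reflect: "reflect_poly (?p ^ N) = ?p ^ N"
    by (simp add: reflect_poly_power)
  have deg_pow: "degree (?p ^ N) = s * N"
    by (simp only: degree_power_eq[OF nz] deg mult.commute)
  have *: "coeff (?p ^ N) j = (if j > s * N then 0 else coeff (?p ^ N) (s * N - j))" for j
    using coeff_reflect_poly[of "?p ^ N" j] by (simp only: reflect deg_pow)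
  show ?thesis
  proof (cases "0 \<le> d \<and> d \<le> int s * int N")
    case True
    then have "nat d \<le> s * N" by (simp add: nat_le_iff)
    moreover have "nat (int s * int N - d) = s * N - nat d"
      using True by (simp add: nat_diff_distrib nat_mult_distrib)
    ultimately show ?thesis
      using True *[of "nat d"] by (simp add: s_binomial_def)
  next
    case False
    have "coeff (?p ^ N) (nat e) = 0" if "e > int s * int N" for e
      using that *[of "nat e"] by (simp add: zless_nat_eq_int_zless)
    then show ?thesis using False by (auto simp: s_binomial_def)
  qed
qed

section \<open>From lattice paths to monomials, and the Catalan triangle\<close>

lemma card_admissible_paths:
  "card {P \<in> admissible_paths N m. Q (monomial_of N m P)} = card {\<alpha> \<in> m_free N m. Q \<alpha>}"
proof -
  have inj: "inj_on (path_of N) (m_free N m)"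
    using path_of_bij[of N m] by (simp add: bij_betw_def)
  have "{P \<in> admissible_paths N m. Q (monomial_of N m P)} = path_of N ` {\<alpha> \<in> m_free N m. Q \<alpha>}"
    using inj by (auto simp: admissible_paths_def monomial_of_def)
  moreover have "inj_on (path_of N) {\<alpha> \<in> m_free N m. Q \<alpha>}"
    using inj by (rule inj_on_subset) auto
  ultimately show ?thesis by (simp add: card_image)
qed

theorem proposition5p11:
  fixes m n k :: nat and r :: "monomial rel"
  assumes "m \<ge> 2" and "n \<ge> 1"
    and "monomial_order (2 * n) r"
    and "vars_decreasing (2 * n) r"
  shows "s_catalan (m - 1) n k =
    int (card {P \<in> admissible_paths (2 * n) (\<lambda>_. m).
      int (path_degree (2 * n) (\<lambda>_. m) P) = int n * (int m - 1) - int k \<and>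
      mon_poly (monomial_of (2 * n) (\<lambda>_. m) P)
        \<notin> initial_ideal (2 * n) r (I1 (2 * n) (\<lambda>_. m) :: 'k::field_char_0 mpoly set)})"
proof -
  obtain s where s: "m = Suc s" using assms(1) by (cases m) auto
  \<comment> \<open>The degree is kept as an integer because k may exceed n s.\<close>
  define D where "D = int n * int s - int k"
  let ?M = "m_free (2 * n) (\<lambda>_. Suc s)"
  let ?std = "standard_monomials (2 * n) r (\<lambda>_. Suc s) TYPE('k)"
  \<comment> \<open>Reflection in the middle degree s n: the cases e = 0 and e = 1 turn s n + k and
    s n + k + 1 into D and D - 1.\<close>
  have sym: "s_binomial s (2 * n) (int s * int (2 * n) - (D - e)) = s_binomial s (2 * n) (D - e)" for e
    by (rule s_binomial_symmetric)
  have lhs: "s_catalan (m - 1) n k = s_binomial s (2 * n) D - s_binomial s (2 * n) (D - 1)"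
    using sym[of 0] sym[of 1] assms(2) by (simp add: s_catalan_def s D_def algebra_simps)
  have "card {P \<in> admissible_paths (2 * n) (\<lambda>_. m).
      int (path_degree (2 * n) (\<lambda>_. m) P) = int n * (int m - 1) - int k \<and>
      mon_poly (monomial_of (2 * n) (\<lambda>_. m) P)
        \<notin> initial_ideal (2 * n) r (I1 (2 * n) (\<lambda>_. m) :: 'k mpoly set)}
    = card {\<alpha> \<in> ?M. int (mdegree \<alpha>) = D \<and>
        mon_poly \<alpha> \<notin> initial_ideal (2 * n) r (I1 (2 * n) (\<lambda>_. m) :: 'k mpoly set)}"
    unfolding path_degree_def by (subst card_admissible_paths) (simp add: s D_def)
  also have "\<dots> = card {\<alpha> \<in> ?std. int (mdegree \<alpha>) = D}"
    by (rule arg_cong[where f = card]) (auto simp: standard_monomials_def s)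
  finally have rhs: "card {P \<in> admissible_paths (2 * n) (\<lambda>_. m).
      int (path_degree (2 * n) (\<lambda>_. m) P) = int n * (int m - 1) - int k \<and>
      mon_poly (monomial_of (2 * n) (\<lambda>_. m) P)
        \<notin> initial_ideal (2 * n) r (I1 (2 * n) (\<lambda>_. m) :: 'k mpoly set)}
    = card {\<alpha> \<in> ?std. int (mdegree \<alpha>) = D}" .
  have "s_binomial s (2 * n) D - s_binomial s (2 * n) (D - 1) = int (card {\<alpha> \<in> ?std. int (mdegree \<alpha>) = D})"
  proof (cases "D \<ge> 0")
    case False
    \<comment> \<open>For negative D there are no monomials, and both coefficients are zero by the
      convention for negative indices.\<close>
    then have "{\<alpha> \<in> ?std. int (mdegree \<alpha>) = D} = {}" by auto
    then show ?thesis using False by (simp only: s_binomial_def) simp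
  next
    case True
    then obtain d where d: "D = int d" using nonneg_int_cases by blast
    \<comment> \<open>The middle degree is n s, and D = n s - k does not exceed it.\<close>
    have "2 * int d < (\<Sum>i=1..2 * n. int (Suc s) - 1) + 2"
      using d by (simp add: D_def algebra_simps)
    from card_standard_monomials[OF assms(3) this, where 'k = 'k]
    have "int (card {\<alpha> \<in> ?std. mdegree \<alpha> = d}) =
        s_binomial s (2 * n) (int d) - int (card {\<alpha> \<in> ?M. Suc (mdegree \<alpha>) = d})"
      unfolding s_binomial_eq_card by linarith
    also have "int (card {\<alpha> \<in> ?M. Suc (mdegree \<alpha>) = d}) = s_binomial s (2 * n) (D - 1)"
    proof (cases d)
      case 0
      then show ?thesis using d by (simp add: s_binomial_def)
    next
      case (Suc e)
      then have "D - 1 = int e" using d by simp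
      then show ?thesis by (simp add: s_binomial_eq_card Suc)
    qed
    finally show ?thesis by (simp add: d)
  qed
  then show ?thesis using lhs rhs by simp
qed

end
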